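(* Let $k$ be a field and $V\subseteq k^n$ an affine algebraic subvariety. The ring $k(V)$ of rational functions over $V$ is a special $*$-algebra over $k$.
   Context: $k$ is an arbitrary field; rings are commutative and unital. $V\subseteq k^n$ is the zero set in $k^n$ of an ideal of $k[X_1,\ldots,X_n]$ (not necessarily irreducible), with the Zariski topology; $k[V]=k[X_1,\ldots,X_n]/\{f:\forall P\in V, f(P)=0\}$, whose elements are viewed as functions $V\to k$. A rational function on $V$ is an equivalence class of pairs $(O,f/g)$, where $O$ is a dense open subset of $V$ and $f,g\in k[V]$ with $g$ simplifiable (a non-zero-divisor of $k[V]$) and nowhere vanishing on $O$; two pairs $(O,f/g)$ and $(U,l/h)$ are equivalent if the functions $f/g$ and $l/h$ coincide on $O\cap U$. These classes form a $k$-algebra $k(V)$ under the natural operations. The algebraic signature $\mathcal D$ of $k$ is the set of all polynomials in finitely many variables over $k$ with no zero rational in $k$. A $k$-algebra $A$ is a $*$-algebra if $D(\bar a)$ is invertible in $A$ for all $D\in\mathcal D$ and appropriate tuples $\bar a$ from $A$. The homogeneous signature $\mathcal H$ of $k$ is the set of all non-zero homogeneous polynomials $P(\bar X,Y)$ over $k$ in finitely many variables $\bar X=(X_1,\ldots,X_n)$ and a distinguished variable $Y$ such that for all $\bar a\in k^n$ and $b\in k$, $P(\bar a,b)=0$ implies $b=0$. A $k$-algebra $A$ is special if for all $P(\bar X,Y)\in\mathcal H$ and $\bar a,b$ from $A$ such that $P(\bar a,b)=0$, we have $b=0$. *)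

theory Defs
  imports
    "HOL-Library.Poly_Mapping"
    "HOL-Algebra.Module"
    "HOL-Algebra.QuotRing"
    "HOL-Algebra.Algebraic_Closure_Type"
    "HOL-Analysis.Abstract_Topology"
begin

section \<open>Polynomials in finitely many variables\<close>

text \<open>Monomials are finitely supported exponent functions, so every element of this type is a
  polynomial in finitely many of the variables \<open>X\<^sub>0, X\<^sub>1, \<dots>\<close>. A tuple at which it is evaluated is
  given as a function on all variable indices; only the finitely many entries at variables that
  occur in the polynomial matter.\<close>

type_synonym 'k mpoly = "(nat \<Rightarrow>\<^sub>0 nat) \<Rightarrow>\<^sub>0 'k"

definition poly_eval :: "'k::field mpoly \<Rightarrow> (nat \<Rightarrow> 'k) \<Rightarrow> 'k"
  where "poly_eval p a =
    (\<Sum>m\<in>Poly_Mapping.keys p. Poly_Mapping.lookup p m *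
      (\<Prod>i\<in>Poly_Mapping.keys m. a i ^ Poly_Mapping.lookup m i))"

definition homogeneous :: "'k::field mpoly \<Rightarrow> bool"
  where "homogeneous p \<longleftrightarrow>
    (\<exists>d. \<forall>m\<in>Poly_Mapping.keys p.
      (\<Sum>i\<in>Poly_Mapping.keys m. Poly_Mapping.lookup m i) = d)"

abbreviation poly_const :: "'k::field \<Rightarrow> 'k mpoly"
  where "poly_const c \<equiv> Poly_Mapping.single 0 c"


section \<open>Special and star algebras over a field\<close>

abbreviation base_field :: "'k::field ring"
  where "base_field \<equiv> ring_of_type_algebra"

definition alg_eval :: "('k::field, 'a) module \<Rightarrow> 'k mpoly \<Rightarrow> (nat \<Rightarrow> 'a) \<Rightarrow> 'a"
  where "alg_eval A p a =
    (\<Oplus>\<^bsub>A\<^esub>m\<in>Poly_Mapping.keys p. Poly_Mapping.lookup p m \<odot>\<^bsub>A\<^esub>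
      (\<Otimes>\<^bsub>A\<^esub>i\<in>Poly_Mapping.keys m. a i [^]\<^bsub>A\<^esub> Poly_Mapping.lookup m i))"

definition algebraic_signature :: "'k::field mpoly set"
  where "algebraic_signature = {D. \<forall>a. poly_eval D a \<noteq> 0}"

definition star_algebra :: "('k::field, 'a) module \<Rightarrow> bool"
  where "star_algebra A \<longleftrightarrow> algebra base_field A \<and>
    (\<forall>D\<in>algebraic_signature. \<forall>a. (\<forall>i. a i \<in> carrier A) \<longrightarrow> alg_eval A D a \<in> Units A)"

text \<open>In the homogeneous signature, variable \<open>0\<close> plays the role of the distinguished variable
  \<open>Y\<close>, and the variables \<open>1, 2, \<dots>\<close> that of \<open>X\<^sub>1, X\<^sub>2, \<dots>\<close>: the value of \<open>P(X, Y)\<close> at \<open>(a, b)\<close> is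
  its value at \<open>case_nat b a\<close>.\<close>

definition homogeneous_signature :: "'k::field mpoly set"
  where "homogeneous_signature =
    {P. P \<noteq> 0 \<and> homogeneous P \<and> (\<forall>a b. poly_eval P (case_nat b a) = 0 \<longrightarrow> b = 0)}"

definition special_algebra :: "('k::field, 'a) module \<Rightarrow> bool"
  where "special_algebra A \<longleftrightarrow> algebra base_field A \<and>
    (\<forall>P\<in>homogeneous_signature. \<forall>a b. (\<forall>i. a i \<in> carrier A) \<longrightarrow> b \<in> carrier A \<longrightarrow>
      alg_eval A P (case_nat b a) = \<zero>\<^bsub>A\<^esub> \<longrightarrow> b = \<zero>\<^bsub>A\<^esub>)"


section \<open>Affine varieties\<close>

definition affine_space :: "nat \<Rightarrow> (nat \<Rightarrow> 'k::field) set"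
  where "affine_space n = {..<n} \<rightarrow>\<^sub>E UNIV"

definition mpoly_ring :: "nat \<Rightarrow> 'k::field mpoly ring"
  where "mpoly_ring n = ring_of_type_algebra
    \<lparr>carrier := {p. \<forall>m\<in>Poly_Mapping.keys p. Poly_Mapping.keys m \<subseteq> {..<n}}\<rparr>"

definition zero_set :: "nat \<Rightarrow> 'k::field mpoly set \<Rightarrow> (nat \<Rightarrow> 'k) set"
  where "zero_set n J = {P \<in> affine_space n. \<forall>p\<in>J. poly_eval p P = 0}"

definition affine_variety :: "nat \<Rightarrow> (nat \<Rightarrow> 'k::field) set \<Rightarrow> bool"
  where "affine_variety n V \<longleftrightarrow> (\<exists>J. ideal J (mpoly_ring n) \<and> V = zero_set n J)"

definition zariski :: "nat \<Rightarrow> (nat \<Rightarrow> 'k::field) topology"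
  where "zariski n =
    topology (\<lambda>U. U \<subseteq> affine_space n \<and> affine_variety n (affine_space n - U))"

definition vanishing_ideal :: "nat \<Rightarrow> (nat \<Rightarrow> 'k::field) set \<Rightarrow> 'k mpoly set"
  where "vanishing_ideal n V = {p \<in> carrier (mpoly_ring n). \<forall>P\<in>V. poly_eval p P = 0}"

definition coord_ring :: "nat \<Rightarrow> (nat \<Rightarrow> 'k::field) set \<Rightarrow> 'k mpoly set ring"
  where "coord_ring n V = mpoly_ring n Quot vanishing_ideal n V"

text \<open>The value of an element of the coordinate ring, i.e. of a coset of polynomials, at a point
  of the variety; all the polynomials in the coset have the same value there.\<close>

definition coord_value :: "'k::field mpoly set \<Rightarrow> (nat \<Rightarrow> 'k) \<Rightarrow> 'k"
  where "coord_value f P = (THE c. \<forall>p\<in>f. poly_eval p P = c)"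


section \<open>Rational functions\<close>

definition simplifiable :: "('a, 'm) ring_scheme \<Rightarrow> 'a \<Rightarrow> bool"
  where "simplifiable R g \<longleftrightarrow>
    g \<in> carrier R \<and> (\<forall>h\<in>carrier R. g \<otimes>\<^bsub>R\<^esub> h = \<zero>\<^bsub>R\<^esub> \<longrightarrow> h = \<zero>\<^bsub>R\<^esub>)"

text \<open>The triple \<open>(U, f, g)\<close> stands for the pair \<open>(U, f/g)\<close>.\<close>

type_synonym 'k fraction_on = "(nat \<Rightarrow> 'k) set \<times> 'k mpoly set \<times> 'k mpoly set"

definition fractions_on :: "nat \<Rightarrow> (nat \<Rightarrow> 'k::field) set \<Rightarrow> 'k fraction_on set"
  where "fractions_on n V = {(U, f, g).
    openin (subtopology (zariski n) V) U \<and> subtopology (zariski n) V closure_of U = V \<and>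
    f \<in> carrier (coord_ring n V) \<and> simplifiable (coord_ring n V) g \<and>
    (\<forall>P\<in>U. coord_value g P \<noteq> 0)}"

definition fraction_rel ::
    "nat \<Rightarrow> (nat \<Rightarrow> 'k::field) set \<Rightarrow> ('k fraction_on \<times> 'k fraction_on) set"
  where "fraction_rel n V = {((U, f, g), (W, l, h)).
    (U, f, g) \<in> fractions_on n V \<and> (W, l, h) \<in> fractions_on n V \<and>
    (\<forall>P\<in>U \<inter> W. coord_value f P / coord_value g P = coord_value l P / coord_value h P)}"

abbreviation fraction_class ::
    "nat \<Rightarrow> (nat \<Rightarrow> 'k::field) set \<Rightarrow> 'k fraction_on \<Rightarrow> 'k fraction_on set"
  where "fraction_class n V t \<equiv> fraction_rel n V `` {t}"

text \<open>As for quotient rings in the library, an operation on classes is the union of the resulting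
  classes over all choices of representatives; all these choices give the same class.\<close>

definition rational_functions ::
    "nat \<Rightarrow> (nat \<Rightarrow> 'k::field) set \<Rightarrow> ('k, 'k fraction_on set) module"
  where "rational_functions n V = (let R = coord_ring n V in
    \<lparr>carrier = fractions_on n V // fraction_rel n V,
     monoid.mult = (\<lambda>x y. \<Union>(U, f, g)\<in>x. \<Union>(W, l, h)\<in>y.
       fraction_class n V (U \<inter> W, f \<otimes>\<^bsub>R\<^esub> l, g \<otimes>\<^bsub>R\<^esub> h)),
     one = fraction_class n V (V, \<one>\<^bsub>R\<^esub>, \<one>\<^bsub>R\<^esub>),
     ring.zero = fraction_class n V (V, \<zero>\<^bsub>R\<^esub>, \<one>\<^bsub>R\<^esub>),
     add = (\<lambda>x y. \<Union>(U, f, g)\<in>x. \<Union>(W, l, h)\<in>y.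
       fraction_class n V (U \<inter> W, f \<otimes>\<^bsub>R\<^esub> h \<oplus>\<^bsub>R\<^esub> l \<otimes>\<^bsub>R\<^esub> g, g \<otimes>\<^bsub>R\<^esub> h)),
     module.smult = (\<lambda>c x. \<Union>(U, f, g)\<in>x.
       fraction_class n V
         (U, (vanishing_ideal n V +>\<^bsub>mpoly_ring n\<^esub> poly_const c) \<otimes>\<^bsub>R\<^esub> f, g))\<rparr>)"

end

theory Submission
  imports Defs
begin

text \<open>The zero locus of an element of \<open>k[V]\<close> is closed, so a rational function is determined by its
  values on any dense open set, and the ring operations of \<open>k(V)\<close> become pointwise operations on
  values in \<open>k\<close>. For \<open>D\<close> without rational zeros, \<open>D(f\<^sub>1/g\<^sub>1, \<dots>)\<close> is a fraction on a dense open set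
  with nowhere vanishing value, hence nowhere vanishing numerator, which is then simplifiable; so the
  fraction can be inverted. For \<open>P\<close> in the homogeneous signature, \<open>P(a, b) = 0\<close> gives
  \<open>P(a(x), b(x)) = 0\<close> and thus \<open>b(x) = 0\<close> at all points \<open>x\<close> of a dense open set.\<close>

section \<open>Evaluation of polynomials\<close>

definition monom_eval :: "(nat \<Rightarrow> 'k::field) \<Rightarrow> (nat \<Rightarrow>\<^sub>0 nat) \<Rightarrow> 'k"
  where "monom_eval a m = (\<Prod>i\<in>Poly_Mapping.keys m. a i ^ Poly_Mapping.lookup m i)"

text \<open>Indices outside the support have exponent 0 and contribute the factor 1. This lets
  monomials with different supports be compared over one common index set.\<close>

lemma monom_eval_superset:
  assumes "finite K" "Poly_Mapping.keys m \<subseteq> K"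
  shows "monom_eval a m = (\<Prod>i\<in>K. a i ^ Poly_Mapping.lookup m i)"
  unfolding monom_eval_def using assms
  by (intro prod.mono_neutral_left) (auto simp: in_keys_iff)

lemma monom_eval_add: "monom_eval a (m + m') = monom_eval a m * monom_eval a m'"
proof -
  let ?K = "Poly_Mapping.keys m \<union> Poly_Mapping.keys m'"
  have "Poly_Mapping.keys (m + m') \<subseteq> ?K"
    by (rule Poly_Mapping.keys_add)
  then show ?thesis
    by (simp add: monom_eval_superset[of ?K] lookup_add power_add prod.distrib)
qed

lemma poly_eval_superset:
  assumes "finite K" "Poly_Mapping.keys p \<subseteq> K"
  shows "poly_eval p a = (\<Sum>m\<in>K. Poly_Mapping.lookup p m * monom_eval a m)"
  unfolding poly_eval_def monom_eval_def using assms
  by (intro sum.mono_neutral_left) (auto simp: in_keys_iff)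

lemma poly_eval_zero [simp]: "poly_eval 0 a = 0"
  by (simp add: poly_eval_def)

lemma poly_eval_add: "poly_eval (p + q) a = poly_eval p a + poly_eval q a"
proof -
  let ?K = "Poly_Mapping.keys p \<union> Poly_Mapping.keys q"
  have "Poly_Mapping.keys (p + q) \<subseteq> ?K"
    by (rule Poly_Mapping.keys_add)
  then show ?thesis
    by (simp add: poly_eval_superset[of ?K] lookup_add sum.distrib algebra_simps)
qed

lemma poly_eval_sum: "poly_eval (\<Sum>i\<in>I. p i) a = (\<Sum>i\<in>I. poly_eval (p i) a)"
  by (induction I rule: infinite_finite_induct) (auto simp: poly_eval_add)

lemma poly_eval_single: "poly_eval (Poly_Mapping.single m c) a = c * monom_eval a m"
  by (subst poly_eval_superset[of "{m}"]) auto

lemma poly_eval_const [simp]: "poly_eval (poly_const c) a = c"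
  by (simp add: poly_eval_single monom_eval_def)

lemma poly_eval_one [simp]: "poly_eval 1 a = 1"
  using poly_eval_const[of 1 a] by simp

lemma poly_eval_uminus: "poly_eval (- p) a = - poly_eval p a"
  using poly_eval_add[of p "- p" a] by (simp add: add_eq_0_iff)

lemma poly_mapping_eq_sum_single:
  "p = (\<Sum>m\<in>Poly_Mapping.keys p. Poly_Mapping.single m (Poly_Mapping.lookup p m))"
  by (rule poly_mapping_eqI)
     (auto simp: lookup_sum lookup_single when_def in_keys_iff)

text \<open>Expanding both factors into single terms reduces the claim to
  \<open>monom_eval_add\<close>.\<close>

lemma poly_eval_mult: "poly_eval (p * q) a = poly_eval p a * poly_eval q a"
proof -
  let ?s = "\<lambda>p::'a mpoly. \<Sum>m\<in>Poly_Mapping.keys p. Poly_Mapping.single m (Poly_Mapping.lookup p m)"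
  have "poly_eval (?s p * ?s q) a = poly_eval (?s p) a * poly_eval (?s q) a"
    by (simp add: sum_product mult_single poly_eval_sum poly_eval_single monom_eval_add
        mult_ac)
  then show ?thesis
    by (simp flip: poly_mapping_eq_sum_single)
qed


section \<open>The polynomial ring and the Zariski topology\<close>

lemma mpoly_ring_simps:
  "carrier (mpoly_ring n) = {p. \<forall>m\<in>Poly_Mapping.keys p. Poly_Mapping.keys m \<subseteq> {..<n}}"
  "p \<otimes>\<^bsub>mpoly_ring n\<^esub> q = p * q" "p \<oplus>\<^bsub>mpoly_ring n\<^esub> q = p + q"
  "\<one>\<^bsub>mpoly_ring n\<^esub> = 1" "\<zero>\<^bsub>mpoly_ring n\<^esub> = 0"
  by (simp_all add: mpoly_ring_def ring_of_type_algebra_def)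

lemma mpoly_ring_add_closed:
  "p \<in> carrier (mpoly_ring n) \<Longrightarrow> q \<in> carrier (mpoly_ring n) \<Longrightarrow> p + q \<in> carrier (mpoly_ring n)"
  using Poly_Mapping.keys_add[of p q] by (fastforce simp: mpoly_ring_simps)

lemma mpoly_ring_mult_closed:
  assumes "p \<in> carrier (mpoly_ring n)" "q \<in> carrier (mpoly_ring n)"
  shows "p * q \<in> carrier (mpoly_ring n)"
proof -
  have "Poly_Mapping.keys m \<subseteq> {..<n}" if m: "m \<in> Poly_Mapping.keys (p * q)" for m
  proof -
    obtain a b where "m = a + b" "a \<in> Poly_Mapping.keys p" "b \<in> Poly_Mapping.keys q"
      using m keys_mult[of p q] by blast
    then show ?thesis
      using assms Poly_Mapping.keys_add[of a b] by (fastforce simp: mpoly_ring_simps)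
  qed
  then show ?thesis
    by (simp add: mpoly_ring_simps)
qed

lemma mpoly_ring_uminus_closed:
  "p \<in> carrier (mpoly_ring n) \<Longrightarrow> - p \<in> carrier (mpoly_ring n)"
  by (simp add: mpoly_ring_simps)

lemma mpoly_ring_const_closed: "poly_const c \<in> carrier (mpoly_ring n)"
  by (simp add: mpoly_ring_simps)

lemma cring_mpoly_ring: "cring (mpoly_ring n)"
proof (rule cringI)
  show "abelian_group (mpoly_ring n)"
  proof (rule abelian_groupI)
    fix x assume "x \<in> carrier (mpoly_ring n)"
    then show "\<exists>y\<in>carrier (mpoly_ring n). y \<oplus>\<^bsub>mpoly_ring n\<^esub> x = \<zero>\<^bsub>mpoly_ring n\<^esub>"
      by (intro bexI[of _ "- x"]) (auto simp: mpoly_ring_simps(2-) mpoly_ring_uminus_closed)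
  next
    show "\<zero>\<^bsub>mpoly_ring n\<^esub> \<in> carrier (mpoly_ring n)"
      by (simp add: mpoly_ring_simps)
  qed (auto simp: mpoly_ring_simps(2-) mpoly_ring_add_closed algebra_simps)
  show "Group.comm_monoid (mpoly_ring n)"
  proof (rule comm_monoidI)
    show "\<one>\<^bsub>mpoly_ring n\<^esub> \<in> carrier (mpoly_ring n)"
      using mpoly_ring_const_closed[of 1 n] by (simp add: mpoly_ring_simps(2-))
  qed (auto simp: mpoly_ring_simps(2-) mpoly_ring_mult_closed algebra_simps)
qed (auto simp: mpoly_ring_simps(2-) algebra_simps)

section \<open>Vanishing ideals and zero sets\<close>

lemma ideal_vanishing_ideal: "ideal (vanishing_ideal n V) (mpoly_ring n)"
proof -
  interpret R: cring "mpoly_ring n"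
    by (rule cring_mpoly_ring)
  \<comment> \<open>The additive inverse of the ring record is only characterised by its equation,
    so it is first identified with negation of polynomials.\<close>
  have inv: "\<ominus>\<^bsub>mpoly_ring n\<^esub> p = - p" if "p \<in> carrier (mpoly_ring n)" for p
    using that by (intro R.minus_equality) (auto simp: mpoly_ring_simps(2-) mpoly_ring_uminus_closed)
  show ?thesis
  proof (rule idealI)
    show "subgroup (vanishing_ideal n V) (add_monoid (mpoly_ring n))"
    proof (rule R.add.subgroupI)
      show "vanishing_ideal n V \<noteq> {}"
        using R.zero_closed by (auto simp: vanishing_ideal_def mpoly_ring_simps(2-))
    qed (auto simp: vanishing_ideal_def inv mpoly_ring_uminus_closed poly_eval_uminus
          poly_eval_add mpoly_ring_add_closed mpoly_ring_simps(2-))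
  qed (auto simp: vanishing_ideal_def poly_eval_mult mpoly_ring_mult_closed mpoly_ring_simps(2-)
        intro: R.ring_axioms)
qed

text \<open>Galois connection: \<open>S\<close> is contained in the vanishing ideal of its own zero
  set. Hence any set of polynomials can be replaced by an ideal with the same zeros.\<close>

lemma zero_set_vanishing_ideal:
  assumes "S \<subseteq> carrier (mpoly_ring n)"
  shows "zero_set n (vanishing_ideal n (zero_set n S)) = zero_set n S"
  using assms by (auto simp: zero_set_def vanishing_ideal_def)

lemma affine_variety_zero_set:
  "S \<subseteq> carrier (mpoly_ring n) \<Longrightarrow> affine_variety n (zero_set n S)"
  unfolding affine_variety_def
  by (metis ideal_vanishing_ideal zero_set_vanishing_ideal)

lemma affine_variety_eq_zero_set:
  assumes "affine_variety n V"
  shows "V = zero_set n (vanishing_ideal n V)"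
proof -
  obtain J where J: "ideal J (mpoly_ring n)" "V = zero_set n J"
    using assms by (auto simp: affine_variety_def)
  then have "J \<subseteq> carrier (mpoly_ring n)"
    by (meson additive_subgroup.a_subset ideal.axioms(1))
  then show ?thesis
    using J zero_set_vanishing_ideal by blast
qed

lemma affine_variety_subset: "affine_variety n V \<Longrightarrow> V \<subseteq> affine_space n"
  by (auto simp: affine_variety_def zero_set_def)

lemma vanishing_ideal_subset: "vanishing_ideal n V \<subseteq> carrier (mpoly_ring n)"
  by (auto simp: vanishing_ideal_def)

text \<open>The products of one equation of \<open>V\<close> and one of \<open>W\<close> cut out the
  union: at a point where some equation of \<open>V\<close> is nonzero, all equations of
  \<open>W\<close> must vanish, as a field has no zero divisors.\<close>

lemma affine_variety_Un:
  assumes "affine_variety n V" "affine_variety n W"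
  shows "affine_variety n (V \<union> W)"
proof -
  let ?S = "{p * q | p q. p \<in> vanishing_ideal n V \<and> q \<in> vanishing_ideal n W}"
  have "zero_set n ?S = zero_set n (vanishing_ideal n V) \<union> zero_set n (vanishing_ideal n W)"
    by (auto simp: zero_set_def poly_eval_mult) (metis mult_eq_0_iff poly_eval_mult)
  then have "zero_set n ?S = V \<union> W"
    using assms by (simp flip: affine_variety_eq_zero_set)
  moreover have "?S \<subseteq> carrier (mpoly_ring n)"
    using vanishing_ideal_subset by (auto intro!: mpoly_ring_mult_closed)
  ultimately show ?thesis
    using affine_variety_zero_set[of ?S n] by simp
qed

text \<open>The union of the vanishing ideals defines the intersection. The factor
  \<open>affine_space n\<close> gives the empty family the whole space as its intersection.\<close>

lemma affine_variety_Int: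
  assumes "\<And>V. V \<in> \<V> \<Longrightarrow> affine_variety n V"
  shows "affine_variety n (affine_space n \<inter> \<Inter>\<V>)"
proof -
  let ?S = "\<Union>V\<in>\<V>. vanishing_ideal n V"
  have "zero_set n ?S = affine_space n \<inter> (\<Inter>V\<in>\<V>. zero_set n (vanishing_ideal n V))"
    by (auto simp: zero_set_def)
  also have "\<dots> = affine_space n \<inter> \<Inter>\<V>"
    using assms affine_variety_eq_zero_set by blast
  finally have "zero_set n ?S = affine_space n \<inter> \<Inter>\<V>" .
  moreover have "?S \<subseteq> carrier (mpoly_ring n)"
    using vanishing_ideal_subset by blast
  ultimately show ?thesis
    by (metis affine_variety_zero_set)
qed

lemma affine_variety_empty: "affine_variety n {}"
proof -
  have "{} = zero_set n {1}"
    by (auto simp: zero_set_def)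
  moreover have "{1} \<subseteq> carrier (mpoly_ring n)"
    using mpoly_ring_const_closed[of 1 n] by simp
  ultimately show ?thesis
    by (metis affine_variety_zero_set)
qed

section \<open>The Zariski topology\<close>

lemma istopology_zariski:
  "istopology (\<lambda>U. U \<subseteq> affine_space n \<and> affine_variety n (affine_space n - U))"
  (is "istopology ?L")
  unfolding istopology_def
proof (intro conjI[of "\<forall>S T. ?L S \<longrightarrow> ?L T \<longrightarrow> ?L (S \<inter> T)"] allI impI)
  fix U W assume "?L U" "?L W"
  then show "?L (U \<inter> W)"
    by (auto simp: Diff_Int affine_variety_Un)
next
  fix \<U> assume U: "\<forall>U\<in>\<U>. ?L U"
  have "affine_space n - \<Union>\<U> = affine_space n \<inter> \<Inter>((\<lambda>U. affine_space n - U) ` \<U>)"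
    by auto
  also have "affine_variety n \<dots>"
    using U by (intro affine_variety_Int) auto
  finally show "?L (\<Union>\<U>)"
    using U by blast
qed

lemma openin_zariski:
  "openin (zariski n) U \<longleftrightarrow>
    U \<subseteq> affine_space n \<and> affine_variety n (affine_space n - U)"
  unfolding zariski_def by (simp add: topology_inverse' istopology_zariski)

lemma topspace_zariski [simp]: "topspace (zariski n) = affine_space n"
proof -
  have "openin (zariski n) (affine_space n)"
    by (simp add: openin_zariski affine_variety_empty)
  then show ?thesis
    by (metis openin_subset openin_topspace openin_zariski subset_antisym)
qed

lemma closedin_zariski: "closedin (zariski n) C \<longleftrightarrow> affine_variety n C"
  unfolding closedin_def
  using affine_variety_subset
  by (auto simp: openin_zariski double_diff)

section \<open>The coordinate ring as a ring of functions\<close>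

lemma vanishing_ideal_eval: "p \<in> vanishing_ideal n V \<Longrightarrow> P \<in> V \<Longrightarrow> poly_eval p P = 0"
  by (simp add: vanishing_ideal_def)

locale variety =
  fixes n :: nat and V :: "(nat \<Rightarrow> 'k::field) set"
  assumes affine_variety: "affine_variety n V"
begin

abbreviation "R \<equiv> coord_ring n V"
abbreviation "I \<equiv> vanishing_ideal n V"
abbreviation "top_V \<equiv> subtopology (zariski n) V"

sublocale P: cring "mpoly_ring n"
  by (rule cring_mpoly_ring)

sublocale I: ideal I "mpoly_ring n"
  by (rule ideal_vanishing_ideal)

sublocale R: cring R
  unfolding coord_ring_def by (rule I.quotient_is_cring) (rule P.is_cring)

abbreviation coset :: "'k mpoly \<Rightarrow> 'k mpoly set"
  where "coset p \<equiv> I +>\<^bsub>mpoly_ring n\<^esub> p"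

text \<open>Members of the coset differ from \<open>p\<close> by polynomials vanishing at
  \<open>P\<close>, and \<open>p\<close> itself is a member, so the description in
  \<open>coord_value\<close> has exactly one solution.\<close>

lemma coord_value_coset:
  assumes "p \<in> carrier (mpoly_ring n)" "P \<in> V"
  shows "coord_value (coset p) P = poly_eval p P"
  unfolding coord_value_def
proof (rule the_equality)
  show "\<forall>q\<in>coset p. poly_eval q P = poly_eval p P"
    using assms(2) by (auto simp: a_r_coset_def' mpoly_ring_simps(2-) poly_eval_add vanishing_ideal_eval)
  show "c = poly_eval p P" if "\<forall>q\<in>coset p. poly_eval q P = c" for c
    using bspec[OF that I.a_rcos_self[OF assms(1)]] by simp
qed

lemma coset_closed: "p \<in> carrier (mpoly_ring n) \<Longrightarrow> coset p \<in> carrier R"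
  by (simp add: coord_ring_def FactRing_def P.a_rcosetsI[OF I.a_subset])

lemma coord_ring_cosetE:
  assumes "f \<in> carrier R"
  obtains p where "p \<in> carrier (mpoly_ring n)" "f = coset p"
  using assms by (auto simp: coord_ring_def FactRing_def A_RCOSETS_defs a_r_coset_def)

lemma coset_hom:
  assumes "p \<in> carrier (mpoly_ring n)" "q \<in> carrier (mpoly_ring n)"
  shows "coset p \<oplus>\<^bsub>R\<^esub> coset q = coset (p + q)" "coset p \<otimes>\<^bsub>R\<^esub> coset q = coset (p * q)"
  using assms
  by (simp_all add: coord_ring_def FactRing_def I.rcoset_mult_add I.a_rcos_sum mpoly_ring_simps(2-))

lemma coord_value_add:
  assumes "f \<in> carrier R" "g \<in> carrier R" "P \<in> V"
  shows "coord_value (f \<oplus>\<^bsub>R\<^esub> g) P = coord_value f P + coord_value g P"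
  using assms
  by (auto elim!: coord_ring_cosetE
      simp: coset_hom coord_value_coset mpoly_ring_add_closed poly_eval_add)

lemma coord_value_mult:
  assumes "f \<in> carrier R" "g \<in> carrier R" "P \<in> V"
  shows "coord_value (f \<otimes>\<^bsub>R\<^esub> g) P = coord_value f P * coord_value g P"
  using assms
  by (auto elim!: coord_ring_cosetE
      simp: coset_hom coord_value_coset mpoly_ring_mult_closed poly_eval_mult)

lemma coord_value_const:
  "P \<in> V \<Longrightarrow> coord_value (coset (poly_const c)) P = c"
  by (simp add: coord_value_coset mpoly_ring_const_closed)

text \<open>Written as cosets of constants, 0 and 1 get their values from
  \<open>coord_value_const\<close>.\<close>

lemma coord_ring_const:
  "\<one>\<^bsub>R\<^esub> = coset (poly_const 1)" "\<zero>\<^bsub>R\<^esub> = coset (poly_const 0)"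
  using P.a_rcos_zero[OF I.is_ideal I.zero_closed]
  by (simp_all add: coord_ring_def FactRing_def mpoly_ring_simps(2-))

lemma coord_value_zero: "P \<in> V \<Longrightarrow> coord_value \<zero>\<^bsub>R\<^esub> P = 0"
  by (simp only: coord_ring_const coord_value_const)

lemma coord_value_one: "P \<in> V \<Longrightarrow> coord_value \<one>\<^bsub>R\<^esub> P = 1"
  by (simp only: coord_ring_const coord_value_const)

text \<open>This is the injectivity of the map from k[V] to functions on \<open>V\<close>: a
  polynomial vanishing on all of \<open>V\<close> lies in the ideal that is divided out.\<close>

lemma coord_ring_eq_zeroI:
  assumes "f \<in> carrier R" "\<And>P. P \<in> V \<Longrightarrow> coord_value f P = 0"
  shows "f = \<zero>\<^bsub>R\<^esub>"
proof -
  obtain p where p: "p \<in> carrier (mpoly_ring n)" "f = coset p"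
    using assms(1) by (rule coord_ring_cosetE)
  have "poly_eval p P = 0" if "P \<in> V" for P
    using assms(2)[OF that] coord_value_coset[OF p(1) that] p(2) by simp
  then have "p \<in> I"
    using p(1) unfolding vanishing_ideal_def by blast
  then show ?thesis
    using p P.a_rcos_zero[OF I.is_ideal] by (simp add: coord_ring_def FactRing_def)
qed


section \<open>Dense open subsets\<close>

lemma topspace_V [simp]: "topspace top_V = V"
  using affine_variety_subset[OF affine_variety] by auto

text \<open>The locus is the trace on \<open>V\<close> of the zero set of any polynomial in the
  coset.\<close>

lemma closedin_coord_value_zero:
  assumes "f \<in> carrier R"
  shows "closedin top_V {P \<in> V. coord_value f P = 0}"
proof -
  obtain p where p: "p \<in> carrier (mpoly_ring n)" "f = coset p"
    using assms by (rule coord_ring_cosetE)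
  have "{P \<in> V. coord_value f P = 0} = V \<inter> zero_set n {p}"
    using affine_variety_subset[OF affine_variety] p
    by (auto simp: zero_set_def coord_value_coset)
  moreover have "closedin (zariski n) (zero_set n {p})"
    using p by (simp add: closedin_zariski affine_variety_zero_set)
  ultimately show ?thesis
    by (simp add: closedin_subtopology_Int_closed)
qed

definition dense_open :: "(nat \<Rightarrow> 'k) set \<Rightarrow> bool"
  where "dense_open U \<longleftrightarrow> openin top_V U \<and> top_V closure_of U = V"

lemma dense_open_subset: "dense_open U \<Longrightarrow> U \<subseteq> V"
  unfolding dense_open_def by (metis openin_subset topspace_V)

text \<open>The zero locus of \<open>f\<close> is closed in \<open>V\<close> and contains
  \<open>U\<close>, hence also the closure of \<open>U\<close>, which is \<open>V\<close>.\<close>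

lemma coord_value_zero_dense:
  assumes "f \<in> carrier R" "dense_open U"
    and "\<And>P. P \<in> U \<Longrightarrow> coord_value f P = 0" "P \<in> V"
  shows "coord_value f P = 0"
proof -
  have "top_V closure_of U \<subseteq> {P \<in> V. coord_value f P = 0}"
    using assms(3) dense_open_subset[OF assms(2)]
    by (intro closure_of_minimal closedin_coord_value_zero[OF assms(1)]) blast
  then show ?thesis
    using assms(2,4) unfolding dense_open_def by blast
qed

lemma dense_open_V: "dense_open V"
  unfolding dense_open_def by (metis closure_of_topspace openin_topspace topspace_V)

text \<open>As \<open>U\<close> is open and \<open>W\<close> is dense, the intersection has the same
  closure as \<open>U\<close>. \<open>V\<close> may be reducible, so density has to be carried along
  explicitly.\<close>

lemma dense_open_Int:
  assumes "dense_open U" "dense_open W"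
  shows "dense_open (U \<inter> W)"
  using assms dense_open_subset closure_of_openin_Int_superset[of top_V U W]
  by (auto simp: dense_open_def)

text \<open>If \<open>g\<close> times \<open>h\<close> is zero, then \<open>h\<close> vanishes
  wherever \<open>g\<close> does not, so on a dense set, so on \<open>V\<close>.\<close>

lemma simplifiable_if_dense:
  assumes "g \<in> carrier R" "dense_open U" "\<And>P. P \<in> U \<Longrightarrow> coord_value g P \<noteq> 0"
  shows "simplifiable R g"
  unfolding simplifiable_def
proof (intro conjI ballI impI assms)
  fix h assume h: "h \<in> carrier R" "g \<otimes>\<^bsub>R\<^esub> h = \<zero>\<^bsub>R\<^esub>"
  have zero: "coord_value h P = 0" if "P \<in> U" for P
    using that assms h coord_value_mult[of g h P] coord_value_zero[of P]
      dense_open_subset[OF assms(2)] by auto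
  show "h = \<zero>\<^bsub>R\<^esub>"
    by (rule coord_ring_eq_zeroI[OF h(1)], rule coord_value_zero_dense[OF h(1) assms(2) zero])
qed


section \<open>Rational functions as functions on dense open subsets\<close>

abbreviation "K \<equiv> rational_functions n V"
abbreviation "cls \<equiv> fraction_class n V"

text \<open>With \<open>simplifiable_if_dense\<close>, checking that a triple is a fraction becomes
  a matter of values on the open set.\<close>

lemma fractions_on_iff:
  "(U, f, g) \<in> fractions_on n V \<longleftrightarrow>
    dense_open U \<and> f \<in> carrier R \<and> g \<in> carrier R \<and> (\<forall>P\<in>U. coord_value g P \<noteq> 0)"
proof -
  have "simplifiable R g \<Longrightarrow> g \<in> carrier R"
    by (simp add: simplifiable_def)
  then show ?thesis
    using simplifiable_if_dense[of g U]
    unfolding fractions_on_def mem_Collect_eq case_prod_conv dense_open_def by blast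
qed

text \<open>After clearing denominators, the claim is the vanishing on \<open>V\<close> of an element of the coordinate
  ring that vanishes on a dense subset.\<close>

lemma fraction_rel_if_dense:
  assumes "(U, f, g) \<in> fractions_on n V" "(W, l, h) \<in> fractions_on n V" "dense_open D"
    and "\<And>P. P \<in> D \<Longrightarrow> P \<in> U \<Longrightarrow> P \<in> W \<Longrightarrow>
      coord_value f P / coord_value g P = coord_value l P / coord_value h P"
  shows "((U, f, g), (W, l, h)) \<in> fraction_rel n V"
proof -
  note fr = assms(1,2)[unfolded fractions_on_iff]
  \<comment> \<open>\<open>?d\<close> is the cross difference of the two fractions. It is built with
    the constant -1 because values are known for sums, products and constants.\<close>
  let ?m = "coset (poly_const (-1))"
  let ?d = "f \<otimes>\<^bsub>R\<^esub> h \<oplus>\<^bsub>R\<^esub> ?m \<otimes>\<^bsub>R\<^esub> (l \<otimes>\<^bsub>R\<^esub> g)"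
  have m: "?m \<in> carrier R"
    by (intro coset_closed mpoly_ring_const_closed)
  have d: "coord_value ?d P = coord_value f P * coord_value h P - coord_value l P * coord_value g P"
    if "P \<in> V" for P
    using that fr m by (simp add: coord_value_add coord_value_mult coord_value_const)
  \<comment> \<open>On this set the fractions agree and both denominators are nonzero, so
    \<open>?d\<close> vanishes there.\<close>
  have D: "dense_open (D \<inter> U \<inter> W)"
    using assms fr by (simp add: dense_open_Int)
  have zero: "coord_value ?d P = 0" if "P \<in> V" for P
  proof (rule coord_value_zero_dense[where U = "D \<inter> U \<inter> W"])
    show "coord_value ?d Q = 0" if "Q \<in> D \<inter> U \<inter> W" for Q
    proof -
      have "Q \<in> V"
        using that D dense_open_subset by blast
      moreover have "coord_value f Q / coord_value g Q = coord_value l Q / coord_value h Q"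
        "coord_value g Q \<noteq> 0" "coord_value h Q \<noteq> 0"
        using that assms(4) fr by auto
      ultimately show ?thesis
        by (simp add: d frac_eq_eq)
    qed
  qed (use that fr m D in simp_all)
  have "coord_value f P / coord_value g P = coord_value l P / coord_value h P"
    if "P \<in> U \<inter> W" for P
  proof -
    have "P \<in> V"
      using that fr dense_open_subset by blast
    then show ?thesis
      using that fr zero[of P] by (simp add: d frac_eq_eq)
  qed
  then show ?thesis
    using assms by (simp add: fraction_rel_def)
qed

lemma equiv_fraction_rel: "equiv (fractions_on n V) (fraction_rel n V)"
proof (rule Equiv_Relations.equivI)
  show "fraction_rel n V \<subseteq> fractions_on n V \<times> fractions_on n V"
    unfolding fraction_rel_def by blast
  show "refl_on (fractions_on n V) (fraction_rel n V)"
    unfolding refl_on_def fraction_rel_def by blast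
  show "sym (fraction_rel n V)"
    unfolding sym_def fraction_rel_def by fastforce
  show "trans (fraction_rel n V)"
  proof (rule transI)
    fix r s t assume rel: "(r, s) \<in> fraction_rel n V" "(s, t) \<in> fraction_rel n V"
    obtain U f g W l h Z p q where eq: "r = (U, f, g)" "s = (W, l, h)" "t = (Z, p, q)"
      by (metis prod_cases3)
    have fr: "(U, f, g) \<in> fractions_on n V" "(W, l, h) \<in> fractions_on n V"
      "(Z, p, q) \<in> fractions_on n V"
      using rel by (simp_all add: eq fraction_rel_def)
    have W: "dense_open W"
      using fr(2) unfolding fractions_on_iff by blast
    show "(r, t) \<in> fraction_rel n V"
      unfolding eq
    \<comment> \<open>The middle fraction gives agreement only inside its own domain
      \<open>W\<close>; density of \<open>W\<close> extends it to all of
      \<open>U \<inter> Z\<close>.\<close>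
    proof (rule fraction_rel_if_dense[OF fr(1,3) W])
      show "coord_value f P / coord_value g P = coord_value p P / coord_value q P"
        if "P \<in> W" "P \<in> U" "P \<in> Z" for P
        using rel that by (simp add: eq fraction_rel_def)
    qed
  qed
qed

text \<open>Only the values of \<open>\<phi>\<close> on the domain of one representative are
  prescribed; elsewhere it is arbitrary. Using total functions avoids tracking domains in
  computations.\<close>

definition represents :: "'k fraction_on set \<Rightarrow> ((nat \<Rightarrow> 'k) \<Rightarrow> 'k) \<Rightarrow> bool"
  where "represents x \<phi> \<longleftrightarrow> (\<exists>U f g. (U, f, g) \<in> fractions_on n V \<and> x = cls (U, f, g) \<and>
    (\<forall>P\<in>U. \<phi> P = coord_value f P / coord_value g P))"

lemma representsI:
  assumes "(U, f, g) \<in> fractions_on n V"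
    and "\<And>P. P \<in> U \<Longrightarrow> \<phi> P = coord_value f P / coord_value g P"
  shows "represents (cls (U, f, g)) \<phi>"
  using assms unfolding represents_def by blast

lemma represents_closed: "represents x \<phi> \<Longrightarrow> x \<in> carrier K"
  by (auto simp: represents_def rational_functions_def Let_def intro: quotientI)

lemma carrierE:
  assumes "x \<in> carrier K"
  obtains \<phi> where "represents x \<phi>"
proof -
  obtain U f g where "(U, f, g) \<in> fractions_on n V" "x = cls (U, f, g)"
    using assms by (auto simp: rational_functions_def Let_def elim!: quotientE)
  then have "represents x (\<lambda>P. coord_value f P / coord_value g P)"
    by (auto simp: represents_def)
  then show ?thesis ..
qed

lemma carrier_familyE:
  assumes "\<forall>i. a i \<in> carrier K"
  obtains \<phi> where "\<And>i. represents (a i) (\<phi> i)"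
proof -
  have "\<exists>\<phi>. represents (a i) \<phi>" for i
    by (rule carrierE[OF assms[rule_format, of i]]) blast
  then have "\<exists>\<phi>. \<forall>i. represents (a i) (\<phi> i)"
    by (intro choice allI)
  then show ?thesis
    using that by blast
qed

text \<open>Equal classes agree on the intersection of two domains, which is dense open. Conversely,
  agreement on any dense open \<open>D\<close> extends to the common domain by
  \<open>fraction_rel_if_dense\<close>.\<close>

lemma represents_eq_iff:
  assumes "represents x \<phi>" "represents y \<psi>"
  shows "x = y \<longleftrightarrow> (\<exists>D. dense_open D \<and> (\<forall>P\<in>D. \<phi> P = \<psi> P))"
proof -
  obtain U f g W l h where x: "(U, f, g) \<in> fractions_on n V" "x = cls (U, f, g)"
      "\<And>P. P \<in> U \<Longrightarrow> \<phi> P = coord_value f P / coord_value g P"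
    and y: "(W, l, h) \<in> fractions_on n V" "y = cls (W, l, h)"
      "\<And>P. P \<in> W \<Longrightarrow> \<psi> P = coord_value l P / coord_value h P"
    using assms by (auto simp: represents_def)
  have "x = y \<longleftrightarrow> ((U, f, g), (W, l, h)) \<in> fraction_rel n V"
    unfolding x y by (rule eq_equiv_class_iff[OF equiv_fraction_rel x(1) y(1)])
  also have "\<dots> \<longleftrightarrow> (\<exists>D. dense_open D \<and> (\<forall>P\<in>D. \<phi> P = \<psi> P))"
  proof
    assume "((U, f, g), (W, l, h)) \<in> fraction_rel n V"
    then have "\<forall>P\<in>U \<inter> W. \<phi> P = \<psi> P"
      by (simp add: fraction_rel_def x y)
    moreover have "dense_open (U \<inter> W)"
      using x y by (simp add: fractions_on_iff dense_open_Int)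
    ultimately show "\<exists>D. dense_open D \<and> (\<forall>P\<in>D. \<phi> P = \<psi> P)"
      by blast
  next
    assume "\<exists>D. dense_open D \<and> (\<forall>P\<in>D. \<phi> P = \<psi> P)"
    then obtain D where D: "dense_open D" "\<forall>P\<in>D. \<phi> P = \<psi> P"
      by blast
    then show "((U, f, g), (W, l, h)) \<in> fraction_rel n V"
      by (intro fraction_rel_if_dense[OF x(1) y(1)]) (auto simp flip: x(3) y(3))
  qed
  finally show ?thesis .
qed

text \<open>With \<open>V\<close> as the dense open set, this turns equations between rational
  functions into identities between values in the field.\<close>

lemma represents_eqI:
  assumes "represents x \<phi>" "represents y \<psi>" "\<And>P. \<phi> P = \<psi> P"
  shows "x = y"
  using represents_eq_iff[OF assms(1,2)] assms(3) dense_open_V by blast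

text \<open>The class contains its own representative, so the union is not empty; if all
  representatives contribute the same set, the union is that set. This evaluates the operations of
  \<open>K\<close>.\<close>

lemma UN_class:
  assumes "(U, f, g) \<in> fractions_on n V"
    and "\<And>U' f' g'. ((U, f, g), (U', f', g')) \<in> fraction_rel n V \<Longrightarrow> C U' f' g' = c"
  shows "(\<Union>(U', f', g')\<in>cls (U, f, g). C U' f' g') = c"
proof -
  have "(U, f, g) \<in> cls (U, f, g)"
    using equiv_class_self[OF equiv_fraction_rel assms(1)] .
  then have "(\<Union>t\<in>cls (U, f, g). case t of (U', f', g') \<Rightarrow> C U' f' g') = c"
    by (intro UN_constant_eq) (use assms(2) in auto)
  then show ?thesis .
qed

lemma cls_eqI: "(s, t) \<in> fraction_rel n V \<Longrightarrow> cls t = cls s"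
  by (metis equiv_class_eq equiv_fraction_rel)

section \<open>The operations of k(V) as pointwise operations\<close>

lemma represents_const:
  "represents \<zero>\<^bsub>K\<^esub> (\<lambda>P. 0)" "represents \<one>\<^bsub>K\<^esub> (\<lambda>P. 1)"
proof -
  have "(V, \<zero>\<^bsub>R\<^esub>, \<one>\<^bsub>R\<^esub>) \<in> fractions_on n V" "(V, \<one>\<^bsub>R\<^esub>, \<one>\<^bsub>R\<^esub>) \<in> fractions_on n V"
    by (auto simp: fractions_on_iff dense_open_V coord_value_one)
  then show "represents \<zero>\<^bsub>K\<^esub> (\<lambda>P. 0)" "represents \<one>\<^bsub>K\<^esub> (\<lambda>P. 1)"
    unfolding rational_functions_def Let_def ring.simps monoid.simps
    by (auto intro!: representsI simp: coord_value_one coord_value_zero)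
qed

text \<open>The product fraction takes the product of the values, so its class depends only on the
  values of the factors. This gives independence of the representatives and the representing
  function at once.\<close>

lemma represents_mult:
  assumes "represents x \<phi>" "represents y \<psi>"
  shows "represents (x \<otimes>\<^bsub>K\<^esub> y) (\<lambda>P. \<phi> P * \<psi> P)"
proof -
  obtain U f g W l h where x: "(U, f, g) \<in> fractions_on n V" "x = cls (U, f, g)"
      "\<And>P. P \<in> U \<Longrightarrow> \<phi> P = coord_value f P / coord_value g P"
    and y: "(W, l, h) \<in> fractions_on n V" "y = cls (W, l, h)"
      "\<And>P. P \<in> W \<Longrightarrow> \<psi> P = coord_value l P / coord_value h P"
    using assms by (auto simp: represents_def)
  let ?t = "\<lambda>U f g W l h. (U \<inter> W, f \<otimes>\<^bsub>R\<^esub> l, g \<otimes>\<^bsub>R\<^esub> h)"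
  have closed: "?t U f g W l h \<in> fractions_on n V"
    if "(U, f, g) \<in> fractions_on n V" "(W, l, h) \<in> fractions_on n V" for U f g W l h
    using that dense_open_subset[of U]
    by (auto simp: fractions_on_iff dense_open_Int coord_value_mult)
  have val: "coord_value (f \<otimes>\<^bsub>R\<^esub> l) P / coord_value (g \<otimes>\<^bsub>R\<^esub> h) P =
      coord_value f P / coord_value g P * (coord_value l P / coord_value h P)"
    if "(U, f, g) \<in> fractions_on n V" "(W, l, h) \<in> fractions_on n V" "P \<in> U \<inter> W"
    for U f g W l h P
    using that dense_open_subset[of U]
    by (auto simp: fractions_on_iff coord_value_mult)
  have "x \<otimes>\<^bsub>K\<^esub> y = cls (?t U f g W l h)"
    unfolding x y rational_functions_def Let_def monoid.simps
  proof (intro UN_class x y)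
    fix U' f' g' W' l' h'
    assume rel: "((U, f, g), (U', f', g')) \<in> fraction_rel n V"
      "((W, l, h), (W', l', h')) \<in> fraction_rel n V"
    then have fr: "(U', f', g') \<in> fractions_on n V" "(W', l', h') \<in> fractions_on n V"
      by (auto simp: fraction_rel_def)
    have "(?t U f g W l h, ?t U' f' g' W' l' h') \<in> fraction_rel n V"
      by (rule fraction_rel_if_dense[OF closed closed dense_open_V])
        (use rel fr x y in \<open>auto simp: val[OF x(1) y(1)] val[OF fr] fraction_rel_def\<close>)
    then show "cls (?t U' f' g' W' l' h') = cls (?t U f g W l h)"
      by (rule cls_eqI)
  qed
  also have "represents \<dots> (\<lambda>P. \<phi> P * \<psi> P)"
    by (rule representsI[OF closed[OF x(1) y(1)]]) (simp add: val[OF x(1) y(1)] x(3) y(3))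
  finally show ?thesis .
qed

text \<open>As for products, with values added over the common denominator, which is nonzero on the
  common domain.\<close>

lemma represents_add:
  assumes "represents x \<phi>" "represents y \<psi>"
  shows "represents (x \<oplus>\<^bsub>K\<^esub> y) (\<lambda>P. \<phi> P + \<psi> P)"
proof -
  obtain U f g W l h where x: "(U, f, g) \<in> fractions_on n V" "x = cls (U, f, g)"
      "\<And>P. P \<in> U \<Longrightarrow> \<phi> P = coord_value f P / coord_value g P"
    and y: "(W, l, h) \<in> fractions_on n V" "y = cls (W, l, h)"
      "\<And>P. P \<in> W \<Longrightarrow> \<psi> P = coord_value l P / coord_value h P"
    using assms by (auto simp: represents_def)
  let ?t = "\<lambda>U f g W l h. (U \<inter> W, f \<otimes>\<^bsub>R\<^esub> h \<oplus>\<^bsub>R\<^esub> l \<otimes>\<^bsub>R\<^esub> g, g \<otimes>\<^bsub>R\<^esub> h)"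
  have closed: "?t U f g W l h \<in> fractions_on n V"
    if "(U, f, g) \<in> fractions_on n V" "(W, l, h) \<in> fractions_on n V" for U f g W l h
    using that dense_open_subset[of U]
    by (auto simp: fractions_on_iff dense_open_Int coord_value_mult)
  have val: "coord_value (f \<otimes>\<^bsub>R\<^esub> h \<oplus>\<^bsub>R\<^esub> l \<otimes>\<^bsub>R\<^esub> g) P / coord_value (g \<otimes>\<^bsub>R\<^esub> h) P =
      coord_value f P / coord_value g P + coord_value l P / coord_value h P"
    if "(U, f, g) \<in> fractions_on n V" "(W, l, h) \<in> fractions_on n V" "P \<in> U \<inter> W"
    for U f g W l h P
    using that dense_open_subset[of U]
    by (auto simp: fractions_on_iff coord_value_mult coord_value_add add_frac_eq)
  have "x \<oplus>\<^bsub>K\<^esub> y = cls (?t U f g W l h)"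
    unfolding x y rational_functions_def Let_def ring.simps
  proof (intro UN_class x y)
    fix U' f' g' W' l' h'
    assume rel: "((U, f, g), (U', f', g')) \<in> fraction_rel n V"
      "((W, l, h), (W', l', h')) \<in> fraction_rel n V"
    then have fr: "(U', f', g') \<in> fractions_on n V" "(W', l', h') \<in> fractions_on n V"
      by (auto simp: fraction_rel_def)
    have "(?t U f g W l h, ?t U' f' g' W' l' h') \<in> fraction_rel n V"
      by (rule fraction_rel_if_dense[OF closed closed dense_open_V])
        (use rel fr x y in \<open>auto simp: val[OF x(1) y(1)] val[OF fr] fraction_rel_def\<close>)
    then show "cls (?t U' f' g' W' l' h') = cls (?t U f g W l h)"
      by (rule cls_eqI)
  qed
  also have "represents \<dots> (\<lambda>P. \<phi> P + \<psi> P)"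
    by (rule representsI[OF closed[OF x(1) y(1)]]) (simp add: val[OF x(1) y(1)] x(3) y(3))
  finally show ?thesis .
qed

lemma represents_smult:
  assumes "represents x \<phi>"
  shows "represents (c \<odot>\<^bsub>K\<^esub> x) (\<lambda>P. c * \<phi> P)"
proof -
  obtain U f g where x: "(U, f, g) \<in> fractions_on n V" "x = cls (U, f, g)"
      "\<And>P. P \<in> U \<Longrightarrow> \<phi> P = coord_value f P / coord_value g P"
    using assms by (auto simp: represents_def)
  let ?t = "\<lambda>U f g. (U, coset (poly_const c) \<otimes>\<^bsub>R\<^esub> f, g)"
  have c: "coset (poly_const c) \<in> carrier R"
    by (intro coset_closed mpoly_ring_const_closed)
  have closed: "?t U f g \<in> fractions_on n V" if "(U, f, g) \<in> fractions_on n V" for U f g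
    using that c by (auto simp: fractions_on_iff)
  have val: "coord_value (coset (poly_const c) \<otimes>\<^bsub>R\<^esub> f) P = c * coord_value f P"
    if "(U, f, g) \<in> fractions_on n V" "P \<in> U" for U f g P
    using that c dense_open_subset[of U]
    by (auto simp: fractions_on_iff coord_value_mult coord_value_const)
  have "c \<odot>\<^bsub>K\<^esub> x = cls (?t U f g)"
    unfolding x rational_functions_def Let_def module.simps
  proof (intro UN_class x)
    fix U' f' g'
    assume rel: "((U, f, g), (U', f', g')) \<in> fraction_rel n V"
    then have fr: "(U', f', g') \<in> fractions_on n V"
      by (auto simp: fraction_rel_def)
    have "(?t U f g, ?t U' f' g') \<in> fraction_rel n V"
      by (rule fraction_rel_if_dense[OF closed closed dense_open_V])
        (use rel fr x in \<open>auto simp: val[OF x(1)] val[OF fr] fraction_rel_def simp flip: times_divide_eq_right\<close>)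
    then show "cls (?t U' f' g') = cls (?t U f g)"
      by (rule cls_eqI)
  qed
  also have "represents \<dots> (\<lambda>P. c * \<phi> P)"
    by (rule representsI[OF closed[OF x(1)]]) (simp add: val[OF x(1)] x(3))
  finally show ?thesis .
qed

text \<open>Numerator and denominator are swapped: where the quotient is nonzero the numerator is
  nonzero, and by \<open>fractions_on_iff\<close> this makes it an admissible denominator.\<close>

lemma represents_inverse:
  assumes "represents x \<phi>" "\<And>P. \<phi> P \<noteq> 0"
  obtains y where "represents y (\<lambda>P. inverse (\<phi> P))"
proof -
  obtain U f g where x: "(U, f, g) \<in> fractions_on n V"
      "\<And>P. P \<in> U \<Longrightarrow> \<phi> P = coord_value f P / coord_value g P"
    using assms by (auto simp: represents_def)
  moreover have "coord_value f P \<noteq> 0" if "P \<in> U" for P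
    using x(2)[OF that] assms(2)[of P] by auto
  ultimately have "(U, g, f) \<in> fractions_on n V"
    by (simp add: fractions_on_iff)
  then have "represents (cls (U, g, f)) (\<lambda>P. inverse (\<phi> P))"
    by (rule representsI) (simp add: x(2))
  then show ?thesis ..
qed

section \<open>The algebra structure of k(V)\<close>

lemmas represents_intros = represents_const represents_mult represents_add represents_smult

lemma cring_K: "cring K"
proof (rule cringI)
  show "abelian_group K"
  proof (rule abelian_groupI)
    fix x assume "x \<in> carrier K"
    then obtain \<phi> where x: "represents x \<phi>"
      by (rule carrierE)
    \<comment> \<open>The scalar multiple by -1 serves as the additive inverse.\<close>
    have "(-1) \<odot>\<^bsub>K\<^esub> x \<oplus>\<^bsub>K\<^esub> x = \<zero>\<^bsub>K\<^esub>"
      \<comment> \<open>The rules build a representing function for each side along the structure of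
        the terms; what remains is an identity in the field. All axioms below follow this
        pattern.\<close>
      by (rule represents_eqI, (rule represents_intros x)+) simp
    then show "\<exists>y\<in>carrier K. y \<oplus>\<^bsub>K\<^esub> x = \<zero>\<^bsub>K\<^esub>"
      using represents_closed represents_smult[OF x] by blast
    show "\<zero>\<^bsub>K\<^esub> \<oplus>\<^bsub>K\<^esub> x = x"
      by (rule represents_eqI, (rule represents_intros x)+) simp
    fix y assume "y \<in> carrier K"
    then obtain \<psi> where y: "represents y \<psi>"
      by (rule carrierE)
    show "x \<oplus>\<^bsub>K\<^esub> y \<in> carrier K"
      by (rule represents_closed, (rule represents_intros x y)+)
    show "x \<oplus>\<^bsub>K\<^esub> y = y \<oplus>\<^bsub>K\<^esub> x"
      by (rule represents_eqI, (rule represents_intros x y)+) simp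
    fix z assume "z \<in> carrier K"
    then obtain \<chi> where z: "represents z \<chi>"
      by (rule carrierE)
    show "x \<oplus>\<^bsub>K\<^esub> y \<oplus>\<^bsub>K\<^esub> z = x \<oplus>\<^bsub>K\<^esub> (y \<oplus>\<^bsub>K\<^esub> z)"
      by (rule represents_eqI, (rule represents_intros x y z)+) simp
  qed (rule represents_closed, rule represents_const)
  show "Group.comm_monoid K"
  proof (rule comm_monoidI)
    fix x assume "x \<in> carrier K"
    then obtain \<phi> where x: "represents x \<phi>"
      by (rule carrierE)
    show "\<one>\<^bsub>K\<^esub> \<otimes>\<^bsub>K\<^esub> x = x"
      by (rule represents_eqI, (rule represents_intros x)+) simp
    fix y assume "y \<in> carrier K"
    then obtain \<psi> where y: "represents y \<psi>"
      by (rule carrierE)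
    show "x \<otimes>\<^bsub>K\<^esub> y \<in> carrier K"
      by (rule represents_closed, (rule represents_intros x y)+)
    show "x \<otimes>\<^bsub>K\<^esub> y = y \<otimes>\<^bsub>K\<^esub> x"
      by (rule represents_eqI, (rule represents_intros x y)+) simp
    fix z assume "z \<in> carrier K"
    then obtain \<chi> where z: "represents z \<chi>"
      by (rule carrierE)
    show "x \<otimes>\<^bsub>K\<^esub> y \<otimes>\<^bsub>K\<^esub> z = x \<otimes>\<^bsub>K\<^esub> (y \<otimes>\<^bsub>K\<^esub> z)"
      by (rule represents_eqI, (rule represents_intros x y z)+) simp
  qed (rule represents_closed, rule represents_const)
  fix x y z assume "x \<in> carrier K" "y \<in> carrier K" "z \<in> carrier K"
  then obtain \<phi> \<psi> \<chi> where xyz: "represents x \<phi>" "represents y \<psi>" "represents z \<chi>"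
    by (metis carrierE)
  show "(x \<oplus>\<^bsub>K\<^esub> y) \<otimes>\<^bsub>K\<^esub> z = x \<otimes>\<^bsub>K\<^esub> z \<oplus>\<^bsub>K\<^esub> y \<otimes>\<^bsub>K\<^esub> z"
    by (rule represents_eqI, (rule represents_intros xyz)+) (simp add: algebra_simps)
qed

sublocale K: cring K
  by (rule cring_K)

lemma algebra_K: "algebra base_field K"
proof (rule algebraI)
  fix a :: 'k and x assume "x \<in> carrier K"
  then obtain \<phi> where x: "represents x \<phi>"
    by (rule carrierE)
  show "a \<odot>\<^bsub>K\<^esub> x \<in> carrier K"
    by (rule represents_closed, (rule represents_intros x)+)
  show "\<one>\<^bsub>base_field\<^esub> \<odot>\<^bsub>K\<^esub> x = x"
    by (rule represents_eqI, (rule represents_intros x)+) (simp add: ring_of_type_algebra_def)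
  fix b :: 'k
  show "(a \<oplus>\<^bsub>base_field\<^esub> b) \<odot>\<^bsub>K\<^esub> x = a \<odot>\<^bsub>K\<^esub> x \<oplus>\<^bsub>K\<^esub> b \<odot>\<^bsub>K\<^esub> x"
    by (rule represents_eqI, (rule represents_intros x)+)
      (simp add: ring_of_type_algebra_def algebra_simps)
  show "(a \<otimes>\<^bsub>base_field\<^esub> b) \<odot>\<^bsub>K\<^esub> x = a \<odot>\<^bsub>K\<^esub> (b \<odot>\<^bsub>K\<^esub> x)"
    by (rule represents_eqI, (rule represents_intros x)+) (simp add: ring_of_type_algebra_def)
next
  fix a :: 'k and x y assume "x \<in> carrier K" "y \<in> carrier K"
  then obtain \<phi> \<psi> where xy: "represents x \<phi>" "represents y \<psi>"
    by (metis carrierE)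
  show "a \<odot>\<^bsub>K\<^esub> (x \<oplus>\<^bsub>K\<^esub> y) = a \<odot>\<^bsub>K\<^esub> x \<oplus>\<^bsub>K\<^esub> a \<odot>\<^bsub>K\<^esub> y"
    by (rule represents_eqI, (rule represents_intros xy)+) (simp add: algebra_simps)
  show "a \<odot>\<^bsub>K\<^esub> x \<otimes>\<^bsub>K\<^esub> y = a \<odot>\<^bsub>K\<^esub> (x \<otimes>\<^bsub>K\<^esub> y)"
    by (rule represents_eqI, (rule represents_intros xy)+) simp
qed (auto intro: K.is_cring)

section \<open>Evaluating polynomials at rational functions\<close>

lemma represents_pow:
  assumes "represents x \<phi>"
  shows "represents (x [^]\<^bsub>K\<^esub> (d::nat)) (\<lambda>P. \<phi> P ^ d)"
proof (induction d)
  case 0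
  show ?case
    by (simp add: represents_const)
next
  case (Suc d)
  show ?case
    using represents_mult[OF Suc assms] by (simp add: mult.commute)
qed

lemma represents_finprod:
  assumes "finite A" "\<And>i. i \<in> A \<Longrightarrow> represents (x i) (\<phi> i)"
  shows "represents (\<Otimes>\<^bsub>K\<^esub>i\<in>A. x i) (\<lambda>P. \<Prod>i\<in>A. \<phi> i P)"
  using assms
proof (induction A rule: finite_induct)
  case empty
  show ?case
    by (simp add: represents_const)
next
  case (insert j F)
  then have "x \<in> F \<rightarrow> carrier K" "x j \<in> carrier K"
    by (auto intro: represents_closed)
  with insert show ?case
    by (simp add: K.finprod_insert represents_mult)
qed

lemma represents_finsum:
  assumes "finite A" "\<And>i. i \<in> A \<Longrightarrow> represents (x i) (\<phi> i)"
  shows "represents (\<Oplus>\<^bsub>K\<^esub>i\<in>A. x i) (\<lambda>P. \<Sum>i\<in>A. \<phi> i P)"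
  using assms
proof (induction A rule: finite_induct)
  case empty
  show ?case
    by (simp add: represents_const)
next
  case (insert j F)
  then have "x \<in> F \<rightarrow> carrier K" "x j \<in> carrier K"
    by (auto intro: represents_closed)
  with insert show ?case
    by (simp add: K.finsum_insert represents_add)
qed

text \<open>\<open>alg_eval\<close> and \<open>poly_eval\<close> are the same expression over
  \<open>K\<close> and over the field, so the claim follows operation by operation.\<close>

lemma represents_alg_eval:
  assumes "\<And>i. represents (a i) (\<phi> i)"
  shows "represents (alg_eval K p a) (\<lambda>P. poly_eval p (\<lambda>i. \<phi> i P))"
  unfolding alg_eval_def poly_eval_def
  by (intro represents_finsum represents_smult represents_finprod represents_pow assms) auto

section \<open>The two properties of k(V)\<close>

lemma star_algebra_K: "star_algebra K"
  unfolding star_algebra_def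
proof (intro conjI ballI allI impI algebra_K)
  fix D :: "'k mpoly" and a :: "nat \<Rightarrow> 'k fraction_on set"
  assume D: "D \<in> algebraic_signature" and "\<forall>i. a i \<in> carrier K"
  from this(2) obtain \<phi> where "\<And>i. represents (a i) (\<phi> i)"
    by (rule carrier_familyE) blast
  then have x: "represents (alg_eval K D a) (\<lambda>P. poly_eval D (\<lambda>i. \<phi> i P))"
    by (rule represents_alg_eval)
  \<comment> \<open>\<open>D\<close> has no zero at any tuple, so this holds even at points where
    the values of the \<open>\<phi> i\<close> are arbitrary.\<close>
  moreover have nz: "poly_eval D (\<lambda>i. \<phi> i P) \<noteq> 0" for P
    using D by (simp add: algebraic_signature_def)
  ultimately obtain y where y: "represents y (\<lambda>P. inverse (poly_eval D (\<lambda>i. \<phi> i P)))"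
    by (rule represents_inverse)
  have "alg_eval K D a \<otimes>\<^bsub>K\<^esub> y = \<one>\<^bsub>K\<^esub>"
    by (rule represents_eqI, rule represents_mult[OF x y], rule represents_const) (simp add: nz)
  then show "alg_eval K D a \<in> Units K"
    using represents_closed[OF x] represents_closed[OF y]
    by (auto simp: Units_def K.m_comm)
qed

lemma special_algebra_K: "special_algebra K"
  unfolding special_algebra_def
proof (intro conjI ballI allI impI algebra_K)
  fix p :: "'k mpoly" and a b
  assume p: "p \<in> homogeneous_signature" and a: "\<forall>i. a i \<in> carrier K" and b: "b \<in> carrier K"
    and eq: "alg_eval K p (case_nat b a) = \<zero>\<^bsub>K\<^esub>"
  obtain \<alpha> where \<alpha>: "\<And>i. represents (a i) (\<alpha> i)"
    using a by (rule carrier_familyE) blast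
  obtain \<beta> where \<beta>: "represents b \<beta>"
    using b by (rule carrierE)
  have "represents (case_nat b a i) (case_nat \<beta> \<alpha> i)" for i
    using \<alpha> \<beta> by (simp split: nat.split)
  then have "represents (alg_eval K p (case_nat b a))
      (\<lambda>P. poly_eval p (\<lambda>i. case_nat \<beta> \<alpha> i P))"
    by (rule represents_alg_eval)
  \<comment> \<open>The zero of \<open>K\<close> is represented by the constant 0, so the hypothesis
    becomes a pointwise equation on a dense open set.\<close>
  from represents_eq_iff[OF this represents_const(1)] eq obtain D where D: "dense_open D"
    "\<And>P. P \<in> D \<Longrightarrow> poly_eval p (\<lambda>i. case_nat \<beta> \<alpha> i P) = 0"
    by blast
  have "\<beta> P = 0" if "P \<in> D" for P
  proof -
    \<comment> \<open>The tuple of values at \<open>P\<close> has \<open>\<beta> P\<close> in the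
      place of the distinguished variable, which is the form required by
      \<open>homogeneous_signature\<close>.\<close>
    have "(\<lambda>i. case_nat \<beta> \<alpha> i P) = case_nat (\<beta> P) (\<lambda>i. \<alpha> i P)"
      by (auto split: nat.split)
    then show ?thesis
      using D(2)[OF that] p by (simp add: homogeneous_signature_def)
  qed
  then show "b = \<zero>\<^bsub>K\<^esub>"
    using represents_eq_iff[OF \<beta> represents_const(1)] D(1) by blast
qed

end

theorem corollary5p15:
  fixes n :: nat and V :: "(nat \<Rightarrow> 'k::field) set"
  assumes "affine_variety n V"
  shows "star_algebra (rational_functions n V) \<and> special_algebra (rational_functions n V)"
proof -
  interpret variety n V
    by unfold_locales (rule assms)
  show ?thesis
    using star_algebra_K special_algebra_K by blast
qed

end
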